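(* Let $n\ge 5$ and $4\le m\le\binom n2$ be integers. Then \[ d(n,1,m)=\begin{cases} n-m+1 & \text{if } 4\le m\le n-1,\\ 2 & \text{if } n\le m\le\binom{n-1}{2},\\ 0 & \text{if } m>\binom{n-1}{2}.\end{cases} \]
   Context: All graphs are finite and simple. For a vertex $u$ of a graph $G$, $N[u]$ is its closed neighborhood (the set consisting of $u$ and all vertices adjacent to $u$). A set $S\subseteq V(G)$ is dominating if every vertex of $G$ lies in $N[s]$ for some $s\in S$. A vertex $u\in V(G)$ is overdominated by $S$ if $|N[u]\cap S|\ge 2$. The cardinality-redundance $CR(S)$ is the number of vertices of $G$ overdominated by $S$, and $CR(G)$ is the minimum of $CR(S)$ over all dominating sets $S$ of $G$. $\gamma_{CR}(G)$ is the minimum size of a dominating set $S$ with $CR(S)=CR(G)$. For integers $n\ge 1$, $0\le k\le n$ and $0\le m\le\binom n2$, $d(n,k,m)$ is the minimum of $\gamma_{CR}(G)$ over all graphs $G$ with $n$ vertices, $m$ edges and $CR(G)=k$; if no such graph exists, $d(n,k,m)=0$. *)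

theory Defs
  imports Complex_Main
begin

text \<open>A finite simple graph is given by a finite vertex set and a set of two-element subsets of
  it.\<close>

definition simple_graph :: "'a set \<Rightarrow> 'a set set \<Rightarrow> bool" where
  "simple_graph V E \<longleftrightarrow> finite V \<and> E \<subseteq> {e. e \<subseteq> V \<and> card e = 2}"

definition closed_nbhd :: "'a set \<Rightarrow> 'a set set \<Rightarrow> 'a \<Rightarrow> 'a set" where
  "closed_nbhd V E u = insert u {v \<in> V. {u, v} \<in> E}"

definition dominating :: "'a set \<Rightarrow> 'a set set \<Rightarrow> 'a set \<Rightarrow> bool" where
  "dominating V E S \<longleftrightarrow> S \<subseteq> V \<and> (\<forall>v\<in>V. \<exists>s\<in>S. v \<in> closed_nbhd V E s)"

definition overdominated :: "'a set \<Rightarrow> 'a set set \<Rightarrow> 'a set \<Rightarrow> 'a \<Rightarrow> bool" where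
  "overdominated V E S u \<longleftrightarrow> card (closed_nbhd V E u \<inter> S) \<ge> 2"

definition CR_set :: "'a set \<Rightarrow> 'a set set \<Rightarrow> 'a set \<Rightarrow> nat" where
  "CR_set V E S = card {u \<in> V. overdominated V E S u}"

text \<open>On the natural numbers, \<open>Inf\<close> of a nonempty set is its least element. The index set of
  \<open>CR\<close> contains \<open>V\<close>, and that of \<open>gamma_CR\<close> contains any set attaining \<open>CR\<close>.\<close>

definition CR :: "'a set \<Rightarrow> 'a set set \<Rightarrow> nat" where
  "CR V E = (INF S\<in>{S. dominating V E S}. CR_set V E S)"

definition gamma_CR :: "'a set \<Rightarrow> 'a set set \<Rightarrow> nat" where
  "gamma_CR V E = (INF S\<in>{S. dominating V E S \<and> CR_set V E S = CR V E}. card S)"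

text \<open>Graphs on sets of natural numbers represent all finite graphs up to isomorphism.\<close>

definition graph_class :: "nat \<Rightarrow> nat \<Rightarrow> nat \<Rightarrow> (nat set \<times> nat set set) set" where
  "graph_class n k m =
     {(V, E). simple_graph V E \<and> card V = n \<and> card E = m \<and> CR V E = k}"

definition d :: "nat \<Rightarrow> nat \<Rightarrow> nat \<Rightarrow> nat" where
  "d n k m =
     (if graph_class n k m = {} then 0
      else (INF (V, E)\<in>graph_class n k m. gamma_CR V E))"

end

theory Submission
  imports Defs
begin

text \<open>
  Let \<open>S\<close> be a dominating set with exactly one overdominated vertex \<open>v\<close>. Two adjacent members of
  \<open>S\<close> would both be overdominated, so \<open>S\<close> is independent, \<open>v\<close> lies outside \<open>S\<close> and has at least
  two neighbours \<open>a\<close>, \<open>b\<close> in \<open>S\<close>, and every other vertex outside \<open>S\<close> has exactly one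
  (\<open>overdominated_once\<close>). In particular \<open>card S \<ge> 2\<close>, and two further bounds follow by counting.

  \<^item> Every vertex outside \<open>S\<close> sends an edge to \<open>S\<close> and \<open>v\<close> sends two, so \<open>n + 1 \<le> m + card S\<close>
    (\<open>overdominated_once_edge_bound\<close>).
  \<^item> If \<open>CR = 1\<close>, no vertex is universal, as a universal vertex alone would give \<open>CR = 0\<close>. Hence
    \<open>v\<close> has a non-neighbour, necessarily different from \<open>a\<close> and \<open>b\<close>. Together with the pair
    \<open>{a, b}\<close> and, for each vertex \<open>w\<close> other than \<open>a\<close>, \<open>b\<close>, \<open>v\<close>, one of the pairs \<open>{a, w}\<close>,
    \<open>{b, w}\<close>, this gives \<open>n - 1\<close> distinct non-edges, so \<open>m \<le> (n - 1) choose 2\<close>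
    (\<open>CR_one_edge_bound\<close>).

  Sharpness needs graphs with such a set \<open>S\<close> but no efficient dominating set, that is, none meeting
  every closed neighbourhood exactly once. Two families suffice, both with \<open>v\<close> adjacent to \<open>a\<close> and
  \<open>b\<close>.

  \<^item> In the sparse family, \<open>a\<close> has \<open>p \<ge> 2\<close> further neighbours, of which \<open>e < p\<close> are joined to
    \<open>v\<close>; the remaining vertices are isolated and belong to \<open>S\<close>. This covers
    \<open>4 \<le> m \<le> 2 * n - 5\<close>.
  \<^item> In the dense family, \<open>b\<close> has one further neighbour \<open>y\<close>, all the other vertices \<open>x\<close> are joined
    to \<open>a\<close> and to \<open>y\<close>, the pair \<open>{v, y}\<close> is a non-edge, and the pairs \<open>{v, x}\<close> and \<open>{x, x'}\<close> are
    arbitrary. This covers \<open>2 * n - 5 \<le> m \<le> (n - 1) choose 2\<close>.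
\<close>

section \<open>Dominating sets with at most one overdominated vertex\<close>

lemma closed_nbhd_sym:
  assumes "u \<in> V" "v \<in> V"
  shows "v \<in> closed_nbhd V E u \<longleftrightarrow> u \<in> closed_nbhd V E v"
  using assms by (auto simp: closed_nbhd_def insert_commute)

lemma dominating_vertex_set: "dominating V E V"
  by (auto simp: dominating_def closed_nbhd_def)

lemma CR_attained: "\<exists>S. dominating V E S \<and> CR_set V E S = CR V E"
proof -
  have "CR V E \<in> CR_set V E ` {S. dominating V E S}"
    unfolding CR_def using dominating_vertex_set[of V E] by (intro Inf_nat_def1) auto
  then show ?thesis by auto
qed

lemma CR_le: "dominating V E S \<Longrightarrow> CR V E \<le> CR_set V E S"
  unfolding CR_def by (intro cINF_lower) auto

lemma gamma_CR_attained: "\<exists>S. dominating V E S \<and> CR_set V E S = CR V E \<and> card S = gamma_CR V E"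
proof -
  have "gamma_CR V E \<in> card ` {S. dominating V E S \<and> CR_set V E S = CR V E}"
    unfolding gamma_CR_def using CR_attained[of V E] by (intro Inf_nat_def1) auto
  then show ?thesis by auto
qed

lemma gamma_CR_le:
  "dominating V E S \<Longrightarrow> CR_set V E S = CR V E \<Longrightarrow> gamma_CR V E \<le> card S"
  unfolding gamma_CR_def by (intro cINF_lower) auto

text \<open>An efficient dominating set meets every closed neighbourhood exactly once, so it dominates
  and overdominates no vertex.\<close>

definition efficient :: "'a set \<Rightarrow> 'a set set \<Rightarrow> 'a set \<Rightarrow> bool" where
  "efficient V E S \<longleftrightarrow> S \<subseteq> V \<and> (\<forall>u\<in>V. \<exists>!s. s \<in> S \<and> s \<in> closed_nbhd V E u)"

lemma efficient_exists: "efficient V E S \<Longrightarrow> u \<in> V \<Longrightarrow> \<exists>s\<in>S. s \<in> closed_nbhd V E u"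
  unfolding efficient_def by blast

lemma efficient_unique:
  assumes "efficient V E S" "s \<in> S" "t \<in> S"
    "s \<in> closed_nbhd V E u" "t \<in> closed_nbhd V E u" "u \<in> V"
  shows "s = t"
  using assms unfolding efficient_def by metis

lemma CR_set_zero_efficient:
  assumes "finite V" and dom: "dominating V E S" and zero: "CR_set V E S = 0"
  shows "efficient V E S"
  unfolding efficient_def
proof (intro conjI ballI)
  show SV: "S \<subseteq> V" using dom by (simp add: dominating_def)
  fix u assume "u \<in> V"
  obtain s where s: "s \<in> S" "s \<in> closed_nbhd V E u"
    using dom \<open>u \<in> V\<close> SV closed_nbhd_sym[of u V] unfolding dominating_def by blast
  have "\<not> overdominated V E S u"
    using assms \<open>u \<in> V\<close> by (auto simp: CR_set_def)
  then have "card (closed_nbhd V E u \<inter> S) \<le> Suc 0"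
    by (simp add: overdominated_def)
  then have "\<And>t. t \<in> S \<Longrightarrow> t \<in> closed_nbhd V E u \<Longrightarrow> t = s"
    using s SV assms(1) finite_subset[of S V] by (auto simp: card_le_Suc0_iff_eq)
  then show "\<exists>!s. s \<in> S \<and> s \<in> closed_nbhd V E u" using s by blast
qed

text \<open>In the structure found here, every vertex outside \<open>S\<close> other than \<open>v\<close> has at most one neighbour
  in \<open>S\<close>; it has at least one because \<open>S\<close> dominates.\<close>

lemma overdominated_once:
  assumes G: "simple_graph V E" and dom: "dominating V E S" and one: "CR_set V E S = 1"
  obtains v a b where "v \<in> V - S" "a \<in> S" "b \<in> S" "a \<noteq> b" "{v, a} \<in> E" "{v, b} \<in> E"
    "\<And>s t. s \<in> S \<Longrightarrow> t \<in> S \<Longrightarrow> {s, t} \<notin> E"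
    "\<And>w s t. w \<in> V - S - {v} \<Longrightarrow> s \<in> S \<Longrightarrow> t \<in> S \<Longrightarrow> {w, s} \<in> E \<Longrightarrow> {w, t} \<in> E \<Longrightarrow> s = t"
proof -
  have fV: "finite V" and noloop: "\<And>x. {x} \<notin> E" using G by (auto simp: simple_graph_def)
  have SV: "S \<subseteq> V" using dom by (simp add: dominating_def)
  then have fS: "finite S" using fV finite_subset by blast
  have ov: "overdominated V E S u"
    if "s \<in> S" "t \<in> S" "s \<noteq> t" "s \<in> closed_nbhd V E u" "t \<in> closed_nbhd V E u" for u s t
  proof -
    have "card {s, t} \<le> card (closed_nbhd V E u \<inter> S)"
      using that fS by (intro card_mono) auto
    then show ?thesis using that by (simp add: overdominated_def)
  qed
  obtain v where v: "{u \<in> V. overdominated V E S u} = {v}"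
    using one unfolding CR_set_def by (auto simp: card_1_singleton_iff)
  have uniq: "u = v" if "u \<in> V" "overdominated V E S u" for u using v that by auto
  have vV: "v \<in> V" and vo: "overdominated V E S v" using v by auto
  obtain a b where ab: "a \<noteq> b" "a \<in> closed_nbhd V E v \<inter> S" "b \<in> closed_nbhd V E v \<inter> S"
    using vo fS unfolding overdominated_def
    by (metis One_nat_def Suc_1 card_le_Suc0_iff_eq finite_Int not_less_eq_eq)
  have indep: "{s, t} \<notin> E" if "s \<in> S" "t \<in> S" for s t
  proof
    assume e: "{s, t} \<in> E"
    then have "s \<noteq> t" using noloop by auto
    moreover have "overdominated V E S s" "overdominated V E S t"
      using that e SV \<open>s \<noteq> t\<close>
      by (auto intro!: ov[of s t] simp: closed_nbhd_def insert_commute)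
    ultimately show False using uniq that SV by blast
  qed
  have "v \<notin> S"
    using ab indep[of v] by (auto simp: closed_nbhd_def)
  moreover have "{v, a} \<in> E" "{v, b} \<in> E" using ab \<open>v \<notin> S\<close> by (auto simp: closed_nbhd_def)
  moreover have "s = t"
    if "w \<in> V - S - {v}" "s \<in> S" "t \<in> S" "{w, s} \<in> E" "{w, t} \<in> E" for w s t
    using that ov[of s t w] uniq[of w] SV by (auto simp: closed_nbhd_def)
  ultimately show ?thesis using that[of v a b] ab vV indep by blast
qed

section \<open>Bounds on the number of edges\<close>

lemma finite_edges: "simple_graph V E \<Longrightarrow> finite E"
  unfolding simple_graph_def by (auto intro: finite_subset[of _ "Pow V"])

lemma overdominated_once_card_ge_2:
  assumes "simple_graph V E" "dominating V E S" "CR_set V E S = 1"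
  shows "2 \<le> card S"
proof (rule overdominated_once[OF assms])
  fix a b assume "a \<in> S" "b \<in> S" "a \<noteq> b"
  moreover have "finite S"
    using assms finite_subset by (auto simp: simple_graph_def dominating_def)
  ultimately show ?thesis using card_mono[of S "{a, b}"] by simp
qed

lemma overdominated_once_edge_bound:
  assumes G: "simple_graph V E" and dom: "dominating V E S" and one: "CR_set V E S = 1"
  shows "card V + 1 \<le> card E + card S"
proof -
  have fV: "finite V" using G by (auto simp: simple_graph_def)
  have SV: "S \<subseteq> V" using dom by (simp add: dominating_def)
  obtain v a b where v: "v \<in> V - S" "a \<in> S" "b \<in> S" "a \<noteq> b" "{v, a} \<in> E" "{v, b} \<in> E"
    using overdominated_once[OF assms] by metis
  have "\<exists>s\<in>S. {w, s} \<in> E" if "w \<in> V - S" for w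
    using that dom unfolding dominating_def closed_nbhd_def by (fastforce simp: insert_commute)
  then obtain g where g: "\<And>w. w \<in> V - S \<Longrightarrow> g w \<in> S \<and> {w, g w} \<in> E" by metis
  \<comment> \<open>Sending \<open>v\<close> to \<open>a\<close> leaves the edge \<open>{v, b}\<close> unused.\<close>
  define f where "f = g(v := a)"
  have f: "f w \<in> S" "{w, f w} \<in> E" if "w \<in> V - S" for w using g that v by (auto simp: f_def)
  have inj: "inj_on (\<lambda>w. {w, f w}) (V - S)"
    using f by (auto simp: inj_on_def doubleton_eq_iff)
  have new: "{v, b} \<notin> (\<lambda>w. {w, f w}) ` (V - S)"
    using f v by (auto simp: doubleton_eq_iff f_def)
  have "card (insert {v, b} ((\<lambda>w. {w, f w}) ` (V - S))) \<le> card E"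
    using f v finite_edges[OF G] by (intro card_mono) auto
  then have "card (V - S) + 1 \<le> card E"
    using new inj fV by (simp add: card_image)
  then show ?thesis using SV fV by (simp add: card_Diff_subset finite_subset)
qed

lemma universal_vertex_CR_zero:
  assumes G: "simple_graph V E" and u: "u \<in> V" "\<And>w. w \<in> V \<Longrightarrow> w \<noteq> u \<Longrightarrow> {u, w} \<in> E"
  shows "CR V E = 0"
proof -
  have "dominating V E {u}" using u by (auto simp: dominating_def closed_nbhd_def)
  moreover have "\<not> overdominated V E {u} w" for w
    using card_mono[of "{u}" "closed_nbhd V E w \<inter> {u}"] by (auto simp: overdominated_def)
  then have "CR_set V E {u} = 0" by (simp add: CR_set_def)
  ultimately show ?thesis using CR_le by (metis le_zero_eq)
qed

lemma card_pairs: "finite V \<Longrightarrow> card {e. e \<subseteq> V \<and> card e = 2} = card V choose 2"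
  by (rule n_subsets)

lemma finite_pairs: "finite V \<Longrightarrow> finite {e. e \<subseteq> V \<and> card e = 2}"
  by (rule finite_subset[of _ "Pow V"]) auto

lemma choose_two_split:
  assumes "1 \<le> n"
  shows "n choose 2 = ((n - 1) choose 2) + (n - 1)"
  using assms by (cases n) (auto simp: numeral_2_eq_2)

lemma CR_one_edge_bound:
  assumes G: "simple_graph V E" and CR1: "CR V E = 1"
  shows "card E \<le> (card V - 1) choose 2"
proof -
  have fV: "finite V" using G by (auto simp: simple_graph_def)
  obtain S where S: "dominating V E S" "CR_set V E S = 1"
    using CR_attained[of V E] CR1 by auto
  have SV: "S \<subseteq> V" using S by (simp add: dominating_def)
  obtain v a b where v: "v \<in> V - S" "a \<in> S" "b \<in> S" "a \<noteq> b" "{v, a} \<in> E" "{v, b} \<in> E"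
    and indep: "\<And>s t. s \<in> S \<Longrightarrow> t \<in> S \<Longrightarrow> {s, t} \<notin> E"
    and uniq: "\<And>w s t. w \<in> V - S - {v} \<Longrightarrow> s \<in> S \<Longrightarrow> t \<in> S \<Longrightarrow> {w, s} \<in> E \<Longrightarrow> {w, t} \<in> E \<Longrightarrow> s = t"
    using overdominated_once[OF G S] by blast
  obtain v' where v': "v' \<in> V" "v' \<noteq> v" "{v, v'} \<notin> E"
    using universal_vertex_CR_zero[OF G, of v] v CR1 by auto
  have ne: "v' \<noteq> a" "v' \<noteq> b" using v v' by auto
  have "\<exists>s\<in>{a, b}. {w, s} \<notin> E" if "w \<in> V - {a, b, v}" for w
    using that uniq[of w a b] indep[of w] v by (cases "w \<in> S") auto
  then obtain g where g: "\<And>w. w \<in> V - {a, b, v} \<Longrightarrow> g w \<in> {a, b} \<and> {w, g w} \<notin> E" by metis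
  \<comment> \<open>The pairs \<open>{w, f w}\<close> for \<open>w\<close> different from \<open>a\<close> are \<open>n - 1\<close> distinct non-edges.\<close>
  define f where "f = g(b := a, v := v')"
  have vab: "v \<noteq> a" "v \<noteq> b" using v by auto
  have f: "f w \<in> V \<and> f w \<noteq> w \<and> {w, f w} \<notin> E" if "w \<in> V - {a}" for w
    using g[of w] that v v' vab SV indep[of b a] by (auto simp: f_def)
  let ?N = "(\<lambda>w. {w, f w}) ` (V - {a})"
  have fab: "f w \<in> {a, b}" if "w \<in> V - {a, b, v}" for w
    using g[OF that] that by (simp add: f_def)
  have f_simps: "f b = a" "f v = v'" using vab by (auto simp: f_def)
  have inj: "inj_on (\<lambda>w. {w, f w}) (V - {a})"
  proof (rule inj_onI)
    fix w z assume wz: "w \<in> V - {a}" "z \<in> V - {a}" and eq: "{w, f w} = {z, f z}"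
    show "w = z"
    proof (rule ccontr)
      assume "w \<noteq> z"
      then have cross: "w = f z" "z = f w" using eq by (auto simp: doubleton_eq_iff)
      have "f z \<in> {a, b}" if "z \<noteq> v" using fab[of z] f_simps wz that by auto
      moreover have "f w \<in> {a, b}" if "w \<noteq> v" using fab[of w] f_simps wz that by auto
      moreover have "f w = a" if "w = b" using f_simps that by simp
      ultimately show False using cross \<open>w \<noteq> z\<close> wz vab by blast
    qed
  qed
  have "E \<inter> ?N = {}" using f by auto
  moreover have "E \<union> ?N \<subseteq> {e. e \<subseteq> V \<and> card e = 2}"
    using f G by (auto simp: simple_graph_def card_2_iff)
  ultimately have "card E + card ?N \<le> card V choose 2"
    using card_mono[OF finite_pairs[OF fV], of "E \<union> ?N"] finite_edges[OF G] fV
    by (simp add: card_pairs card_Un_disjoint)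
  moreover have "card ?N = card V - 1" using inj v SV by (auto simp: card_image)
  moreover have "1 \<le> card V" using v fV by (auto simp: Suc_le_eq card_gt_0_iff)
  ultimately show ?thesis using choose_two_split[of "card V"] by simp
qed

section \<open>From graphs to values of \<open>d\<close>\<close>

text \<open>The fixed vertex \<open>v\<close> is the one overdominated by \<open>S\<close>.\<close>

lemma CR_eq_1I:
  assumes G: "simple_graph V E" and S: "dominating V E S"
    and ov: "\<And>u. u \<in> V \<Longrightarrow> overdominated V E S u \<longleftrightarrow> u = v" and v: "v \<in> V"
    and no: "\<And>T. \<not> efficient V E T"
  shows "CR V E = 1" "gamma_CR V E \<le> card S"
proof -
  have "{u \<in> V. overdominated V E S u} = {v}" using ov v by auto
  then have one: "CR_set V E S = 1" by (simp add: CR_set_def)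
  have "CR_set V E T \<noteq> 0" if "dominating V E T" for T
    using no[of T] CR_set_zero_efficient[OF _ that] G by (auto simp: simple_graph_def)
  then have "CR V E \<noteq> 0" using CR_attained[of V E] by metis
  then show c: "CR V E = 1" using CR_le[OF S] one by simp
  show "gamma_CR V E \<le> card S" using gamma_CR_le[OF S] one c by simp
qed

lemma d_le:
  assumes "(V, E) \<in> graph_class n k m"
  shows "d n k m \<le> gamma_CR V E"
proof -
  have "(INF (V, E)\<in>graph_class n k m. gamma_CR V E) \<le> gamma_CR V E"
    using assms by (intro cINF_lower2[where x = "(V, E)"]) auto
  then show ?thesis using assms by (auto simp: d_def)
qed

lemma d_ge:
  assumes "graph_class n k m \<noteq> {}" "\<And>V E. (V, E) \<in> graph_class n k m \<Longrightarrow> c \<le> gamma_CR V E"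
  shows "c \<le> d n k m"
proof -
  have "c \<le> (INF (V, E)\<in>graph_class n k m. gamma_CR V E)"
    using assms by (intro cINF_greatest) auto
  then show ?thesis using assms(1) by (simp add: d_def)
qed

lemma gamma_CR_lower_bounds:
  assumes "(V, E) \<in> graph_class n 1 m"
  shows "n + 1 \<le> m + gamma_CR V E" "2 \<le> gamma_CR V E"
proof -
  have G: "simple_graph V E" "card V = n" "card E = m" "CR V E = 1"
    using assms by (auto simp: graph_class_def)
  obtain S where S: "dominating V E S" "CR_set V E S = 1" "card S = gamma_CR V E"
    using gamma_CR_attained[of V E] G by auto
  show "n + 1 \<le> m + gamma_CR V E"
    using overdominated_once_edge_bound[OF G(1) S(1,2)] G S by simp
  show "2 \<le> gamma_CR V E"
    using overdominated_once_card_ge_2[OF G(1) S(1,2)] S by simp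
qed

section \<open>Sparse graphs\<close>

text \<open>The vertices \<open>0\<close>, \<open>1\<close>, \<open>2\<close> play the roles of \<open>a\<close>, \<open>b\<close>, \<open>v\<close>. The vertices from \<open>3\<close> to
  \<open>p + 2\<close> are the further neighbours of \<open>0\<close>, and the first \<open>e\<close> of them are joined to \<open>2\<close>.\<close>

definition sparse_edges :: "nat \<Rightarrow> nat \<Rightarrow> nat set set" where
  "sparse_edges p e = {{0, 2}, {1, 2}} \<union> (\<lambda>x. {0, x}) ` {3..<3 + p} \<union> (\<lambda>x. {2, x}) ` {3..<3 + e}"

lemma card_sparse_edges: "card (sparse_edges p e) = 2 + p + e"
proof -
  have i1: "card ((\<lambda>x. {0, x}) ` {3..<3 + p}) = p"
    by (subst card_image) (auto simp: inj_on_def doubleton_eq_iff)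
  have i2: "card ((\<lambda>x. {2, x}) ` {3..<3 + e}) = e"
    by (subst card_image) (auto simp: inj_on_def doubleton_eq_iff)
  have "card ({{0, 2}, {1, 2}} \<union> (\<lambda>x. {0, x}) ` {3..<3 + p} :: nat set set) = 2 + p"
    using i1 by (subst card_Un_disjoint) (auto simp: doubleton_eq_iff)
  then show ?thesis unfolding sparse_edges_def
    using i2 by (subst card_Un_disjoint) (auto simp: doubleton_eq_iff)
qed

lemma sparse_edges_iff:
  assumes "e \<le> p"
  shows "{x, y} \<in> sparse_edges p e \<longleftrightarrow>
    x = 0 \<and> 2 \<le> y \<and> y < 3 + p \<or> y = 0 \<and> 2 \<le> x \<and> x < 3 + p \<or>
    x = 2 \<and> (y = 1 \<or> 3 \<le> y \<and> y < 3 + e) \<or> y = 2 \<and> (x = 1 \<or> 3 \<le> x \<and> x < 3 + e)"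
proof -
  have "y = 2 \<or> 3 \<le> y" if "2 \<le> y" for y :: nat using that by arith
  then show ?thesis
    using assms unfolding sparse_edges_def
    by (auto simp: doubleton_eq_iff image_iff)
qed

lemma sparse_graph:
  assumes p: "2 \<le> p" and e: "e < p" and n: "3 + p \<le> n"
  shows "({..<n}, sparse_edges p e) \<in> graph_class n 1 (2 + p + e)"
    and "gamma_CR {..<n} (sparse_edges p e) \<le> n - p - 1"
proof -
  let ?V = "{..<n}" and ?E = "sparse_edges p e"
  let ?S = "{0, 1} \<union> {3 + p..<n}"
  note edge = sparse_edges_iff[OF less_imp_le[OF e]]
  have G: "simple_graph ?V ?E"
    using assms by (auto simp: simple_graph_def sparse_edges_def card_insert_if)
  have nb: "s \<in> closed_nbhd ?V ?E u \<longleftrightarrow> s = u \<or> s < n \<and> {u, s} \<in> ?E" for s u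
    by (auto simp: closed_nbhd_def)
  have dom: "dominating ?V ?E ?S"
  proof -
    have "\<exists>s\<in>?S. w \<in> closed_nbhd ?V ?E s" if "w < n" for w
    proof (cases "w \<in> ?S")
      case True then show ?thesis by (auto simp: nb)
    next
      case False
      then have "w \<in> closed_nbhd ?V ?E 0" using that by (auto simp: nb edge)
      then show ?thesis by blast
    qed
    then show ?thesis using n by (auto simp: dominating_def)
  qed
  have ov: "overdominated ?V ?E ?S u \<longleftrightarrow> u = 2" if "u \<in> ?V" for u
  proof -
    have N0: "0 \<in> closed_nbhd ?V ?E u \<longleftrightarrow> u < 3 + p \<and> u \<noteq> 1"
      using n by (simp add: nb edge) arith
    have N1: "1 \<in> closed_nbhd ?V ?E u \<longleftrightarrow> u = 1 \<or> u = 2"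
      using n by (simp add: nb edge) arith
    have isolated: "s \<in> closed_nbhd ?V ?E u \<longleftrightarrow> u = s" if "s \<in> {3 + p..<n}" for s
      using that e by (simp add: nb edge) arith
    have *: "closed_nbhd ?V ?E u \<inter> ?S =
        (if u = 2 then {0, 1} else if u < 3 + p \<and> u \<noteq> 1 then {0} else {u})" (is "?L = ?R")
    proof (rule set_eqI)
      fix s
      consider "s = 0" | "s = 1" | "s \<in> {3 + p..<n}" | "s \<notin> ?S" by blast
      then show "s \<in> ?L \<longleftrightarrow> s \<in> ?R"
      proof cases
        case 1 then show ?thesis using N0 by simp arith
      next
        case 2 then show ?thesis using N1 by simp arith
      next
        case 3 then show ?thesis using isolated[OF 3] by simp arith
      next
        case 4 then show ?thesis using \<open>u \<in> ?V\<close> by simp arith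
      qed
    qed
    show ?thesis unfolding overdominated_def * by simp
  qed
  have no: "\<not> efficient ?V ?E T" for T
  proof
    assume T: "efficient ?V ?E T"
    note ex = efficient_exists[OF T] and un = efficient_unique[OF T]
    have "1 \<in> T \<or> 2 \<in> T" using ex[of 1] n by (auto simp: nb edge)
    then show False
    proof
      assume 1: "1 \<in> T"
      have "0 \<notin> T" using un[of 1 0 2] 1 n by (auto simp: nb edge)
      moreover have "2 \<notin> T" using un[of 1 2 2] 1 n by (auto simp: nb edge)
      ultimately have "x \<in> T" if "3 \<le> x" "x < 3 + p" for x
        using ex[of x] that n by (auto simp: nb edge)
      then have "3 \<in> T" "4 \<in> T" using p by auto
      then show False using un[of 3 4 0] p n by (auto simp: nb edge)
    next
      assume 2: "2 \<in> T"
      have "0 \<notin> T" using un[of 2 0 0] 2 n by (auto simp: nb edge)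
      moreover have "2 + p \<notin> T" using un[of 2 "2 + p" 0] 2 n p by (auto simp: nb edge)
      ultimately show False
        \<comment> \<open>Since \<open>e < p\<close>, the only neighbour of \<open>2 + p\<close> is \<open>0\<close>.\<close>
        using ex[of "2 + p"] p e n by (auto simp: nb edge)
    qed
  qed
  have "2 \<in> ?V" using n by auto
  note CR1 = CR_eq_1I[OF G dom ov this no]
  show "(?V, ?E) \<in> graph_class n 1 (2 + p + e)"
    using G CR1(1) by (simp add: graph_class_def card_sparse_edges)
  have "card ?S = n - p - 1" using n by (subst card_Un_disjoint) auto
  then show "gamma_CR ?V ?E \<le> n - p - 1" using CR1(2) by simp
qed

section \<open>Dense graphs\<close>

text \<open>Both sets live on the vertices below \<open>n\<close>.
  The vertices \<open>0\<close>, \<open>1\<close>, \<open>2\<close>, \<open>3\<close> play the roles of \<open>a\<close>, \<open>b\<close>, \<open>v\<close>, \<open>y\<close>. The edge set may be any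
  set of pairs that contains \<open>dense_edges\<close> and avoids \<open>dense_non_edges\<close>.\<close>

definition dense_edges :: "nat \<Rightarrow> nat set set" where
  "dense_edges n = {{0, 2}, {1, 2}, {1, 3}} \<union> (\<lambda>x. {0, x}) ` {4..<n} \<union> (\<lambda>x. {3, x}) ` {4..<n}"

text \<open>The non-edges keep \<open>{0, 1}\<close> independent and give no vertex other than \<open>2\<close> a second neighbour in
  \<open>{0, 1}\<close>. The pair \<open>{2, 3}\<close> is added so that \<open>2\<close> is not universal.\<close>

definition dense_non_edges :: "nat \<Rightarrow> nat set set" where
  "dense_non_edges n = {{0, 1}, {0, 3}, {2, 3}} \<union> (\<lambda>x. {1, x}) ` {4..<n}"

lemma card_dense_edges:
  assumes "4 \<le> n" shows "card (dense_edges n) = 2 * n - 5"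
proof -
  have i1: "card ((\<lambda>x. {c, x}) ` {4..<n}) = n - 4" if "c < 4" for c
    using that by (subst card_image) (auto simp: inj_on_def doubleton_eq_iff)
  have "card ({{0, 2}, {1, 2}, {1, 3}} \<union> (\<lambda>x. {0, x}) ` {4..<n} :: nat set set) = 3 + (n - 4)"
    using i1[of 0] by (subst card_Un_disjoint) (auto simp: doubleton_eq_iff card_insert_if)
  then show ?thesis unfolding dense_edges_def
    using i1[of 3] assms by (subst card_Un_disjoint) (auto simp: doubleton_eq_iff)
qed

lemma card_dense_non_edges:
  assumes "4 \<le> n" shows "card (dense_non_edges n) = n - 1"
proof -
  have "card ((\<lambda>x. {1, x}) ` {4..<n}) = n - 4"
    by (subst card_image) (auto simp: inj_on_def doubleton_eq_iff)
  moreover have "card {{0, 1}, {0, 3}, {2, 3 :: nat}} = 3"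
    by (simp add: doubleton_eq_iff)
  moreover have "{{0, 1}, {0, 3}, {2, 3 :: nat}} \<inter> (\<lambda>x. {1, x}) ` {4..<n} = {}"
    by (simp add: doubleton_eq_iff image_iff)
  ultimately show ?thesis
    unfolding dense_non_edges_def using assms by (subst card_Un_disjoint) simp_all
qed

lemma dense_edge_set_exists:
  assumes n: "5 \<le> n" and m: "2 * n - 5 \<le> m" "m \<le> (n - 1) choose 2"
  obtains E where "simple_graph {..<n} E" "card E = m"
    "dense_edges n \<subseteq> E" "E \<inter> dense_non_edges n = {}"
proof -
  let ?P = "{e. e \<subseteq> {..<n} \<and> card e = 2}"
  let ?K = "?P - dense_non_edges n"
  have "dense_non_edges n \<subseteq> ?P"
    using n by (auto simp: dense_non_edges_def card_insert_if)
  then have "card ?K = (n choose 2) - (n - 1)"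
    using card_pairs[of "{..<n}"] card_dense_non_edges[of n] n finite_pairs[of "{..<n}"]
    by (simp add: card_Diff_subset finite_subset)
  then have K: "card ?K = (n - 1) choose 2" using choose_two_split[of n] n by simp
  have "dense_edges n \<subseteq> ?P"
    using n by (auto simp: dense_edges_def card_insert_if)
  moreover have "e \<notin> dense_non_edges n" if "e \<in> dense_edges n" for e
    using that unfolding dense_edges_def dense_non_edges_def
    by (elim UnE insertE imageE emptyE; simp add: doubleton_eq_iff image_iff)
  ultimately have sub: "dense_edges n \<subseteq> ?K" by blast
  obtain E where E: "dense_edges n \<subseteq> E" "E \<subseteq> ?K" "card E = m"
    using exists_subset_between[of "dense_edges n" m ?K] sub K m card_dense_edges[of n] n
      finite_pairs[of "{..<n}"] by auto
  then have "simple_graph {..<n} E" by (auto simp: simple_graph_def)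
  moreover have "E \<inter> dense_non_edges n = {}" using E(2) by blast
  ultimately show ?thesis using that[of E] E by blast
qed

lemma dense_graph:
  assumes n: "5 \<le> n" and G: "simple_graph {..<n} E"
    and edges: "dense_edges n \<subseteq> E" and non_edges: "E \<inter> dense_non_edges n = {}"
  shows "CR {..<n} E = 1" "gamma_CR {..<n} E \<le> 2"
proof -
  let ?V = "{..<n}"
  have nb: "s \<in> closed_nbhd ?V E u \<longleftrightarrow> s = u \<or> s < n \<and> {u, s} \<in> E" for s u
    by (auto simp: closed_nbhd_def)
  have small: "u = 0 \<or> u = 1 \<or> u = 2 \<or> u = 3 \<or> 4 \<le> u" for u :: nat by arith
  have in_E: "{0, 2} \<in> E" "{1, 2} \<in> E" "{1, 3} \<in> E"
    "\<And>x. 4 \<le> x \<Longrightarrow> x < n \<Longrightarrow> {0, x} \<in> E" "\<And>x. 4 \<le> x \<Longrightarrow> x < n \<Longrightarrow> {3, x} \<in> E"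
    using edges by (auto simp: dense_edges_def)
  have not_in_E: "{0, 1} \<notin> E" "{0, 3} \<notin> E" "{2, 3} \<notin> E"
    "\<And>x. 4 \<le> x \<Longrightarrow> x < n \<Longrightarrow> {1, x} \<notin> E"
    using non_edges by (auto simp: dense_non_edges_def)
  have noloop: "{x} \<notin> E" for x using G by (auto simp: simple_graph_def)
  have N0: "s \<in> closed_nbhd ?V E 0 \<longleftrightarrow> s = 0 \<or> s = 2 \<or> 4 \<le> s \<and> s < n" for s
    using n small[of s] in_E not_in_E noloop[of 0] by (auto simp: nb)
  have N1: "s \<in> closed_nbhd ?V E 1 \<longleftrightarrow> s = 1 \<or> s = 2 \<or> s = 3" for s
    using n small[of s] in_E not_in_E noloop[of 1] by (auto simp: nb insert_commute)
  have N3: "s \<in> closed_nbhd ?V E 3 \<longleftrightarrow> s = 1 \<or> s = 3 \<or> 4 \<le> s \<and> s < n" for s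
    using n small[of s] in_E not_in_E noloop[of 3] by (auto simp: nb insert_commute)
  have N_sym: "s \<in> closed_nbhd ?V E u \<longleftrightarrow> u \<in> closed_nbhd ?V E s" if "s < n" "u < n" for s u
    using closed_nbhd_sym[of u ?V s E] that by simp
  have dom: "dominating ?V E {0, 1}"
    unfolding dominating_def using n N0 N1 small by fastforce
  have ov: "overdominated ?V E {0, 1} u \<longleftrightarrow> u = 2" if "u \<in> ?V" for u
  proof -
    have "0 \<in> closed_nbhd ?V E u \<longleftrightarrow> u = 0 \<or> u = 2 \<or> 4 \<le> u"
      using that n N0[of u] N_sym[of 0 u] by auto
    moreover have "1 \<in> closed_nbhd ?V E u \<longleftrightarrow> u = 1 \<or> u = 2 \<or> u = 3"
      using that n N1[of u] N_sym[of 1 u] by auto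
    ultimately have *: "closed_nbhd ?V E u \<inter> {0, 1} =
        (if u = 2 then {0, 1} else if u = 0 \<or> 4 \<le> u then {0} else {1})"
      using small[of u] by auto
    show ?thesis unfolding overdominated_def * by simp
  qed
  have no: "\<not> efficient ?V E T" for T
  proof
    assume T: "efficient ?V E T"
    note ex = efficient_exists[OF T] and un = efficient_unique[OF T]
    obtain s where s: "s \<in> T" "s = 0 \<or> s = 2 \<or> 4 \<le> s \<and> s < n" using ex[of 0] n N0 by auto
    obtain t where t: "t \<in> T" "t = 1 \<or> t = 2 \<or> t = 3" using ex[of 1] n N1 by auto
    obtain r where r: "r \<in> T" "r = 1 \<or> r = 3 \<or> 4 \<le> r \<and> r < n" using ex[of 3] n N3 by auto
    consider "1 \<in> T" | "2 \<in> T" | "3 \<in> T" using t by auto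
    then show False
    proof cases
      case 1
      \<comment> \<open>The vertex \<open>s\<close> of \<open>T\<close> that dominates \<open>0\<close> differs from \<open>1\<close>, and lies together with \<open>1\<close> in the
        closed neighbourhood of \<open>2\<close> (if \<open>s \<in> {0, 2}\<close>) or of \<open>3\<close> (otherwise).\<close>
      then have "s \<notin> {0, 2}"
        using un[of 1 s 2] s n in_E by (auto simp: nb insert_commute)
      then show False using un[of 1 s 3] 1 s n by (auto simp: N3)
    next
      case 2
      then have "r \<notin> {1, 3}" using un[of 2 r 1] r n by (auto simp: N1 simp del: One_nat_def)
      then show False using un[of 2 r 0] 2 r n by (auto simp: N0)
    next
      case 3
      have "s \<noteq> 2" using un[of 3 s 1] 3 s n by (auto simp: N1 simp del: One_nat_def)
      moreover have "\<not> 4 \<le> s" using un[of 3 s 3] 3 s n by (auto simp: N3)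
      ultimately have "0 \<in> T" using s by auto
      then show False using un[of 3 0 4] 3 n in_E by (auto simp: nb insert_commute)
    qed
  qed
  have "2 \<in> ?V" using n by auto
  note CR1 = CR_eq_1I[OF G dom ov this no]
  show "CR ?V E = 1" using CR1(1) .
  show "gamma_CR ?V E \<le> 2" using CR1(2) by simp
qed

section \<open>The values of \<open>d\<close> for \<open>CR = 1\<close>\<close>

theorem theorem4p5:
  fixes n m :: nat
  assumes "n \<ge> 5" and "4 \<le> m" and "m \<le> n choose 2"
  shows "(4 \<le> m \<and> m \<le> n - 1 \<longrightarrow> d n 1 m = n - m + 1) \<and>
         (n \<le> m \<and> m \<le> (n - 1) choose 2 \<longrightarrow> d n 1 m = 2) \<and>
         (m > (n - 1) choose 2 \<longrightarrow> d n 1 m = 0)"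
proof (intro conjI impI)
  assume m: "4 \<le> m \<and> m \<le> n - 1"
  let ?E = "sparse_edges (m - 2) 0"
  have bounds: "2 \<le> m - 2" "0 < m - 2" "3 + (m - 2) \<le> n" and eq: "2 + (m - 2) + 0 = m"
    using m assms by arith+
  have mem: "({..<n}, ?E) \<in> graph_class n 1 m"
    using sparse_graph(1)[OF bounds] unfolding eq .
  have le: "gamma_CR {..<n} ?E \<le> n - m + 1"
    using sparse_graph(2)[OF bounds] m assms by simp
  have "n - m + 1 \<le> d n 1 m"
    using mem gamma_CR_lower_bounds(1)[of _ _ n m] m by (intro d_ge) fastforce+
  then show "d n 1 m = n - m + 1" using d_le[OF mem] le by simp
next
  assume m: "n \<le> m \<and> m \<le> (n - 1) choose 2"
  have "\<exists>V E. (V, E) \<in> graph_class n 1 m \<and> gamma_CR V E \<le> 2"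
  proof (cases "m \<le> 2 * n - 5")
    case True
    then have bounds: "2 \<le> n - 3" "m + 1 - n < n - 3" "3 + (n - 3) \<le> n"
      and eq: "2 + (n - 3) + (m + 1 - n) = m"
      using m assms by arith+
    show ?thesis
      using sparse_graph(1)[OF bounds, unfolded eq] sparse_graph(2)[OF bounds] assms(1)
      by (intro exI[of _ "{..<n}"] exI[of _ "sparse_edges (n - 3) (m + 1 - n)"]) simp
  next
    case False
    then obtain E where E: "simple_graph {..<n} E" "card E = m"
      "dense_edges n \<subseteq> E" "E \<inter> dense_non_edges n = {}"
      using dense_edge_set_exists[of n m] assms m by auto
    then show ?thesis using dense_graph[OF assms(1) E(1,3,4)]
      by (intro exI[of _ "{..<n}"] exI[of _ E]) (auto simp: graph_class_def)
  qed
  then obtain V E where VE: "(V, E) \<in> graph_class n 1 m" "gamma_CR V E \<le> 2" by blast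
  have "2 \<le> d n 1 m" using VE gamma_CR_lower_bounds(2) by (intro d_ge) auto
  then show "d n 1 m = 2" using d_le[OF VE(1)] VE(2) by simp
next
  assume m: "m > (n - 1) choose 2"
  have "graph_class n 1 m = {}"
    using CR_one_edge_bound m by (fastforce simp: graph_class_def)
  then show "d n 1 m = 0" by (simp add: d_def)
qed

end
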